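(* Let $N\ge 1$, $P>0$, $I>0$, and for $i=1,\dots,N$ let $G_i>0$ and $\gamma_i>0$. Let $\psi:\mathbb{R}_+\to\mathbb{R}_+$ be increasing, concave and differentiable. For each $i$ let $f_i:\mathbb{R}_+\to\mathbb{R}$ be either a best effort reward function or a delay QoS reward function (as defined in the context). Then the function $$b=(b_1,\dots,b_N)\ \longmapsto\ \sum_{i=1}^N f_i\left(b_i\,\psi\left(\frac{G_i\min(\gamma_i b_i,P)}{I\,b_i}\right)\right)$$ is concave on $\{b\in\mathbb{R}^N:\ b_i\ge 0 \text{ for all } i\}$.
   Context: $\mathbb{R}_+=[0,\infty)$. At $b_i=0$ the ratio $\min(\gamma_i b_i,P)/b_i$ is read as its limit $\gamma_i$, so the argument of $f_i$ is $0$ there. Best effort reward function: $f(r)=\frac1\alpha U\big((1-\alpha)x+\alpha r\big)$, where $0<\alpha<1$, $x\ge 0$ are constants and $U:\mathbb{R}_+\to\mathbb{R}$ is strictly concave and increasing. Delay QoS reward function: given $\Delta>0$, an integer $\pi\ge1$, packet sizes $s(1),\dots,s(\pi)>0$ and packet delays $d(1)>\dots>d(\pi)\ge 0$, with the convention $d(\pi+1)=0$, put $n(r)=\max\{k\in\{0,\dots,\pi\}:\sum_{j=1}^k s(j)\le r\Delta\}$ and $$f(r)=\sum_{j=1}^{n(r)}s(j)d(j)+\Big(r\Delta-\sum_{j=1}^{n(r)}s(j)\Big)d(n(r)+1),\qquad r\ge 0 .$$ *)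

theory Defs
  imports "HOL-Analysis.Analysis"
begin

text \<open>Functions on \<open>[0, \<infinity>)\<close> are modelled as total functions on \<^typ>\<open>real\<close>
  that are constrained only on \<open>{0..}\<close>.\<close>

definition strictly_concave_on :: "real set \<Rightarrow> (real \<Rightarrow> real) \<Rightarrow> bool" where
  "strictly_concave_on S U \<longleftrightarrow> convex S \<and>
    (\<forall>x\<in>S. \<forall>y\<in>S. \<forall>t. x \<noteq> y \<and> 0 < t \<and> t < 1 \<longrightarrow>
       t * U x + (1 - t) * U y < U (t * x + (1 - t) * y))"

definition best_effort_reward :: "(real \<Rightarrow> real) \<Rightarrow> bool" where
  "best_effort_reward f \<longleftrightarrow>
    (\<exists>\<alpha> x U. 0 < \<alpha> \<and> \<alpha> < 1 \<and> 0 \<le> x \<and>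
       strictly_concave_on {0..} U \<and> mono_on {0..} U \<and>
       (\<forall>r\<ge>0. f r = 1 / \<alpha> * U ((1 - \<alpha>) * x + \<alpha> * r)))"

definition packets_served :: "real \<Rightarrow> nat \<Rightarrow> (nat \<Rightarrow> real) \<Rightarrow> real \<Rightarrow> nat" where
  "packets_served \<Delta> p s r = Max {k \<in> {0..p}. (\<Sum>j=1..k. s j) \<le> r * \<Delta>}"

text \<open>The number of packets is written \<open>p\<close>; only the values \<open>s 1, \<dots>, s p\<close> and
  \<open>d 1, \<dots>, d (p + 1)\<close> matter.\<close>

definition delay_qos_reward :: "(real \<Rightarrow> real) \<Rightarrow> bool" where
  "delay_qos_reward f \<longleftrightarrow>
    (\<exists>\<Delta> p s d. 0 < \<Delta> \<and> 1 \<le> p \<and>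
       (\<forall>j\<in>{1..p}. 0 < s j) \<and>
       (\<forall>i\<in>{1..p}. \<forall>j\<in>{1..p}. i < j \<longrightarrow> d j < d i) \<and>
       0 \<le> d p \<and> d (p + 1) = 0 \<and>
       (\<forall>r\<ge>0. let n = packets_served \<Delta> p s r in
          f r = (\<Sum>j=1..n. s j * d j) + (r * \<Delta> - (\<Sum>j=1..n. s j)) * d (n + 1)))"

text \<open>The ratio \<open>min (\<gamma> b) P / b\<close>, with its limit \<open>\<gamma>\<close> as the value at \<open>b = 0\<close>
  (where division in HOL would give \<open>0\<close>).\<close>

definition power_ratio :: "real \<Rightarrow> real \<Rightarrow> real \<Rightarrow> real" where
  "power_ratio \<gamma> P b = (if b = 0 then \<gamma> else min (\<gamma> * b) P / b)"

end

theory Submission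
  imports Defs
begin

text \<open>
  Both kinds of reward function are nondecreasing and concave on \<open>[0, \<infinity>)\<close>; a delay QoS reward is
  the pointwise minimum of its affine pieces. The rate \<open>b \<psi>(c min(\<gamma>b, P) / b)\<close> is the perspective
  \<open>(b, z) \<mapsto> b \<psi>(z / b)\<close> of a concave nondecreasing function, evaluated at the concave function
  \<open>z = c min(\<gamma>b, P)\<close>, hence is itself concave and nonnegative. A nondecreasing concave function of a
  concave function is concave.
\<close>

section \<open>Composition with concave nondecreasing functions\<close>

lemma concave_on_mono_compose:
  fixes g :: "real \<Rightarrow> real" and h :: "'a::real_vector \<Rightarrow> real"
  assumes g: "concave_on T g" and mono: "mono_on T g"
    and h: "concave_on S h" and sub: "h ` S \<subseteq> T"
  shows "concave_on S (\<lambda>x. g (h x))"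
  unfolding concave_on_iff
proof (intro conjI ballI allI impI)
  show S: "convex S"
    using h by (simp add: concave_on_iff)
  have T: "convex T"
    using g by (simp add: concave_on_iff)
  fix x y and u v :: real
  assume xy: "x \<in> S" "y \<in> S" and uv: "0 \<le> u" "0 \<le> v" "u + v = 1"
  have hT: "h x \<in> T" "h y \<in> T"
    using xy sub by auto
  have "u * g (h x) + v * g (h y) \<le> g (u * h x + v * h y)"
    using g hT uv by (simp add: concave_on_iff)
  also have "\<dots> \<le> g (h (u *\<^sub>R x + v *\<^sub>R y))"
  proof (rule mono_onD[OF mono])
    show "u * h x + v * h y \<in> T"
      using convexD[OF T hT uv] by simp
    show "h (u *\<^sub>R x + v *\<^sub>R y) \<in> T"
      using convexD[OF S xy uv] sub by blast
    show "u * h x + v * h y \<le> h (u *\<^sub>R x + v *\<^sub>R y)"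
      using h xy uv by (simp add: concave_on_iff)
  qed
  finally show "u * g (h x) + v * g (h y) \<le> g (h (u *\<^sub>R x + v *\<^sub>R y))" .
qed

section \<open>Best effort rewards\<close>

lemma best_effort_reward_concave_mono:
  assumes "best_effort_reward f"
  shows "concave_on {0..} f" and "mono_on {0..} f"
proof -
  obtain \<alpha> x U where \<alpha>: "0 < \<alpha>" "\<alpha> < 1" and x: "0 \<le> x"
    and U: "strictly_concave_on {0..} U" "mono_on {0..} U"
    and f: "\<And>r. r \<ge> 0 \<Longrightarrow> f r = 1 / \<alpha> * U ((1 - \<alpha>) * x + \<alpha> * r)"
    using assms unfolding best_effort_reward_def by blast
  have arg: "0 \<le> (1 - \<alpha>) * x + \<alpha> * r" if "r \<ge> 0" for r
    using \<alpha> x that by simp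
  \<comment> \<open>Strict concavity speaks only of distinct points and weights strictly between 0
    and 1. In the remaining cases both sides are equal, so the weak inequality holds for all
    weights.\<close>
  have Uconc: "u * U y + v * U z \<le> U (u * y + v * z)"
    if yz: "0 \<le> y" "0 \<le> z" and uv: "0 \<le> u" "0 \<le> v" "u + v = 1" for u v y z
  proof -
    have v: "v = 1 - u"
      using uv by simp
    consider "y = z" | "u = 0" | "u = 1" | "y \<noteq> z" "0 < u" "u < 1"
      using uv by linarith
    then show ?thesis
    proof cases
      case 1
      then show ?thesis
        using \<open>u + v = 1\<close> by (simp flip: distrib_right)
    next
      case 4
      then show ?thesis
        using U(1) yz unfolding strictly_concave_on_def v by (simp add: less_imp_le)
    qed (use v in auto)
  qed
  show "concave_on {0..} f"
    unfolding concave_on_iff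
  proof (intro conjI ballI allI impI)
    fix y z u v :: real
    assume yz: "y \<in> {0..}" "z \<in> {0..}" and uv: "0 \<le> u" "0 \<le> v" "u + v = 1"
    \<comment> \<open>The inner map is affine, so it commutes with convex combinations; the constant
      term survives because the weights sum to 1.\<close>
    have eq: "u * ((1 - \<alpha>) * x + \<alpha> * y) + v * ((1 - \<alpha>) * x + \<alpha> * z)
        = (1 - \<alpha>) * x + \<alpha> * (u * y + v * z)"
    proof -
      have v: "v = 1 - u"
        using uv by simp
      show ?thesis
        unfolding v by (simp add: algebra_simps)
    qed
    have "u * U ((1 - \<alpha>) * x + \<alpha> * y) + v * U ((1 - \<alpha>) * x + \<alpha> * z)
        \<le> U ((1 - \<alpha>) * x + \<alpha> * (u * y + v * z))"
      using Uconc[OF arg arg uv, of y z] yz unfolding eq by simp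
    then have "1 / \<alpha> * (u * U ((1 - \<alpha>) * x + \<alpha> * y) + v * U ((1 - \<alpha>) * x + \<alpha> * z))
        \<le> 1 / \<alpha> * U ((1 - \<alpha>) * x + \<alpha> * (u * y + v * z))"
      using \<alpha> by (intro mult_left_mono) auto
    then show "u * f y + v * f z \<le> f (u *\<^sub>R y + v *\<^sub>R z)"
      using yz uv f by (simp add: algebra_simps)
  qed simp
  show "mono_on {0..} f"
  proof (rule mono_onI)
    fix y z :: real
    assume yz: "y \<in> {0..}" "z \<in> {0..}" "y \<le> z"
    have "U ((1 - \<alpha>) * x + \<alpha> * y) \<le> U ((1 - \<alpha>) * x + \<alpha> * z)"
      using yz \<alpha> arg by (intro mono_onD[OF U(2)]) auto
    then show "f y \<le> f z"
      using yz \<alpha> f by (simp add: divide_right_mono)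
  qed
qed

section \<open>Delay QoS rewards as minima of affine functions\<close>

text \<open>Together \<open>le\<close> and \<open>attained\<close> make \<open>f\<close> the minimum
  of the affine pieces. For concavity take the piece active at the convex combination, for
  monotonicity the one active at the larger point; it bounds \<open>f\<close> from above at the
  other points.\<close>

lemma min_of_affine_concave_mono:
  fixes f :: "real \<Rightarrow> real"
  assumes S: "convex S"
    and le: "\<And>r k. r \<in> S \<Longrightarrow> k \<in> K \<Longrightarrow> f r \<le> a k + m k * r"
    and attained: "\<And>r. r \<in> S \<Longrightarrow> \<exists>k\<in>K. f r = a k + m k * r"
    and slope: "\<And>k. k \<in> K \<Longrightarrow> 0 \<le> m k"
  shows "concave_on S f" and "mono_on S f"
proof -
  show "concave_on S f"
    unfolding concave_on_iff
  proof (intro conjI ballI allI impI)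
    fix x y u v :: real
    assume xy: "x \<in> S" "y \<in> S" and uv: "0 \<le> u" "0 \<le> v" "u + v = 1"
    obtain k where k: "k \<in> K" "f (u *\<^sub>R x + v *\<^sub>R y) = a k + m k * (u *\<^sub>R x + v *\<^sub>R y)"
      using attained convexD[OF S xy uv] by blast
    have "u * f x + v * f y \<le> u * (a k + m k * x) + v * (a k + m k * y)"
      using le xy uv k by (intro add_mono mult_left_mono) auto
    also have "\<dots> = (u + v) * a k + m k * (u * x + v * y)"
      by (simp add: algebra_simps)
    finally show "u * f x + v * f y \<le> f (u *\<^sub>R x + v *\<^sub>R y)"
      using k uv by simp
  qed (fact S)
  show "mono_on S f"
  proof (rule mono_onI)
    fix x y
    assume xy: "x \<in> S" "y \<in> S" "x \<le> y"
    obtain k where k: "k \<in> K" "f y = a k + m k * y"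
      using attained xy by blast
    have "f x \<le> a k + m k * x"
      using le xy k by blast
    also have "\<dots> \<le> f y"
      using k xy slope by (simp add: mult_left_mono)
    finally show "f x \<le> f y" .
  qed
qed

text \<open>Reduces comparing the active piece \<open>n\<close> with an arbitrary piece to comparing
  neighbours: induction walks away from \<open>n\<close>, upwards or downwards.\<close>

lemma unimodal_min:
  fixes g :: "nat \<Rightarrow> real"
  assumes dec: "\<And>k. k < n \<Longrightarrow> g (Suc k) \<le> g k"
    and inc: "\<And>k. n \<le> k \<Longrightarrow> k < p \<Longrightarrow> g k \<le> g (Suc k)"
    and "k \<le> p"
  shows "g n \<le> g k"
proof (cases "n \<le> k")
  case True
  then show ?thesis
    using \<open>k \<le> p\<close>
  proof (induction k rule: dec_induct)
    case (step k)
    then show ?case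
      using inc[of k] by simp
  qed simp
next
  case False
  then have "k \<le> n"
    by simp
  then show ?thesis
  proof (induction k rule: inc_induct)
    case (step k)
    then show ?case
      using dec[of k] by simp
  qed simp
qed

text \<open>Extend the formula for \<open>k\<close> served packets to all \<open>r\<close>, giving
  one affine piece per \<open>k\<close>. As \<open>k\<close> grows, these pieces decrease until
  \<open>k\<close> is the number of packets actually served and increase afterwards, so the defining
  formula picks the smallest piece.\<close>

lemma delay_qos_reward_concave_mono:
  assumes "delay_qos_reward f"
  shows "concave_on {0..} f" and "mono_on {0..} f"
proof -
  obtain \<Delta> p s d where \<Delta>: "0 < \<Delta>" and p: "1 \<le> p"
    and s: "\<forall>j\<in>{1..p}. 0 < s j"
    and d: "\<forall>i\<in>{1..p}. \<forall>j\<in>{1..p}. i < j \<longrightarrow> d j < d i"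
    and d_last: "0 \<le> d p" "d (p + 1) = 0"
    and f_eq: "\<forall>r\<ge>0. f r = (\<Sum>j=1..packets_served \<Delta> p s r. s j * d j)
       + (r * \<Delta> - (\<Sum>j=1..packets_served \<Delta> p s r. s j)) * d (packets_served \<Delta> p s r + 1)"
    using assms unfolding delay_qos_reward_def Let_def by (elim exE conjE)
  define S where "S k = (\<Sum>j=1..k. s j)" for k
  \<comment> \<open>Intercept and slope of
    \<open>(\<Sum>j=1..k. s j * d j) + (r * \<Delta> - S k) * d (Suc k)\<close> as a function of
    \<open>r\<close>.\<close>
  define a where "a k = (\<Sum>j=1..k. s j * d j) - S k * d (Suc k)" for k
  define m where "m k = \<Delta> * d (Suc k)" for k
  have d_nonneg: "0 \<le> d (Suc k)" if kp: "k \<le> p" for k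
  proof -
    consider "k = p" | "Suc k = p" | "Suc k < p"
      using kp by linarith
    then show ?thesis
    proof cases
      case 3
      then show ?thesis
        using d[rule_format, of "Suc k" p] d_last p by simp
    qed (use d_last in auto)
  qed
  \<comment> \<open>At \<open>Suc k = p\<close> the next delay is the conventional value 0, so the
    comparison rests on \<open>0 \<le> d p\<close> and may be an equality.\<close>
  have d_Suc: "d (Suc (Suc k)) \<le> d (Suc k)" if "k < p" for k
    using d[rule_format, of "Suc k" "Suc (Suc k)"] d_nonneg[of k] d_last that
    by (cases "Suc k = p") (auto simp: less_imp_le)
  have S_Suc: "S (Suc k) = S k + s (Suc k)" for k
    by (simp add: S_def)
  have S_mono: "S k \<le> S l" if "k \<le> l" "l \<le> p" for k l
    unfolding S_def using that by (intro sum_mono2) (auto intro!: less_imp_le s[rule_format])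
  \<comment> \<open>Neighbouring pieces cross at \<open>r * \<Delta> = S (Suc k)\<close>. For
    \<open>k < p\<close> the second factor is nonnegative, so the order of the pieces depends on
    whether packet \<open>Suc k\<close> still fits.\<close>
  have piece_diff: "(a k + m k * r) - (a (Suc k) + m (Suc k) * r)
      = (r * \<Delta> - S (Suc k)) * (d (Suc k) - d (Suc (Suc k)))" for k r
    by (simp add: a_def m_def S_Suc algebra_simps)
  {
    fix r :: real
    assume r: "r \<in> {0..}"
    define n where "n = packets_served \<Delta> p s r"
    let ?A = "{k \<in> {0..p}. S k \<le> r * \<Delta>}"
    have n_Max: "n = Max ?A"
      by (simp add: n_def packets_served_def S_def)
    have "0 \<in> ?A"
      using r \<Delta> by (simp add: S_def)
    then have "n \<in> ?A"
      unfolding n_Max by (intro Max_in) auto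
    then have n: "n \<le> p" "S n \<le> r * \<Delta>"
      by auto
    have above: "r * \<Delta> < S k" if "n < k" "k \<le> p" for k
    proof (rule ccontr)
      assume "\<not> r * \<Delta> < S k"
      then have "k \<le> n"
        unfolding n_Max using that by (intro Max_ge) auto
      then show False
        using that by simp
    qed
    have f: "f r = a n + m n * r"
      using f_eq[rule_format, of r] r by (simp add: n_def[symmetric] a_def m_def S_def algebra_simps)
    \<comment> \<open>For \<open>l < n\<close> we have
      \<open>S (Suc l) \<le> S n \<le> r * \<Delta>\<close>; for \<open>n \<le> l < p\<close>
      maximality of \<open>n\<close> gives \<open>r * \<Delta> < S (Suc l)\<close>.\<close>
    have "a n + m n * r \<le> a k + m k * r" if "k \<le> p" for k
    proof (rule unimodal_min[where g = "\<lambda>k. a k + m k * r", OF _ _ that])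
      fix l
      assume l: "l < n"
      have "0 \<le> (r * \<Delta> - S (Suc l)) * (d (Suc l) - d (Suc (Suc l)))"
        using S_mono[of "Suc l" n] d_Suc[of l] l n by (intro mult_nonneg_nonneg) auto
      then show "a (Suc l) + m (Suc l) * r \<le> a l + m l * r"
        using piece_diff[of l r] by simp
    next
      fix l
      assume l: "n \<le> l" "l < p"
      have "(r * \<Delta> - S (Suc l)) * (d (Suc l) - d (Suc (Suc l))) \<le> 0"
        using above[of "Suc l"] d_Suc[of l] l by (intro mult_nonpos_nonneg) auto
      then show "a l + m l * r \<le> a (Suc l) + m (Suc l) * r"
        using piece_diff[of l r] by simp
    qed
    note f this n(1)
  }
  then have le: "\<And>r k. r \<in> {0..} \<Longrightarrow> k \<in> {..p} \<Longrightarrow> f r \<le> a k + m k * r"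
    and attained: "\<And>r. r \<in> {0..} \<Longrightarrow> \<exists>k\<in>{..p}. f r = a k + m k * r"
    by auto
  have slope: "\<And>k. k \<in> {..p} \<Longrightarrow> 0 \<le> m k"
    using \<Delta> d_nonneg by (simp add: m_def)
  show "concave_on {0..} f" "mono_on {0..} f"
    using min_of_affine_concave_mono[of "{0..}" "{..p}" f a m, OF _ le attained slope] by auto
qed

section \<open>Concavity of the rate\<close>

text \<open>Concavity is asked of \<open>b * q b\<close>, the second argument of the perspective,
  rather than of the ratio \<open>q\<close>.\<close>

lemma concave_on_perspective:
  fixes \<psi> q :: "real \<Rightarrow> real"
  assumes \<psi>: "concave_on {0..} \<psi>" "mono_on {0..} \<psi>"
    and q: "\<And>b. 0 \<le> b \<Longrightarrow> 0 \<le> q b"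
    and z: "concave_on {0..} (\<lambda>b. b * q b)"
  shows "concave_on {0..} (\<lambda>b. b * \<psi> (q b))"
  unfolding concave_on_iff
proof (intro conjI ballI allI impI)
  fix x y u v :: real
  assume xy: "x \<in> {0..}" "y \<in> {0..}" and uv: "0 \<le> u" "0 \<le> v" "u + v = 1"
  define b where "b = u * x + v * y"
  have nonneg: "0 \<le> u * x" "0 \<le> v * y"
    using xy uv by simp_all
  have "u * (x * \<psi> (q x)) + v * (y * \<psi> (q y)) \<le> b * \<psi> (q b)"
  proof (cases "b = 0")
    case True
    then have "u * x = 0" "v * y = 0"
      using nonneg b_def by linarith+
    then show ?thesis
      using True by (auto simp: mult.assoc[symmetric] simp del: mult_eq_0_iff)
  next
    case False
    then have b: "0 < b"
      using nonneg b_def by linarith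
    \<comment> \<open>The mean of \<open>q x\<close> and \<open>q y\<close> with weights rescaled by
      \<open>x / b\<close> and \<open>y / b\<close>; they sum to 1 since
      \<open>b = u * x + v * y\<close>, so concavity of \<open>\<psi>\<close> applies at
      \<open>w\<close>.\<close>
    define w where "w = (u * x) / b * q x + (v * y) / b * q y"
    have w: "0 \<le> w"
      unfolding w_def using nonneg b q xy by (intro add_nonneg_nonneg mult_nonneg_nonneg) auto
    have "u * (x * \<psi> (q x)) + v * (y * \<psi> (q y))
        = b * ((u * x) / b * \<psi> (q x) + (v * y) / b * \<psi> (q y))"
      using b by (simp add: field_simps)
    also have "\<dots> \<le> b * \<psi> w"
    proof (rule mult_left_mono)
      have "(u * x) / b + (v * y) / b = 1"
        using b by (simp add: b_def flip: add_divide_distrib)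
      moreover have "0 \<le> (u * x) / b" "0 \<le> (v * y) / b"
        using nonneg b by simp_all
      moreover have "q x \<in> {0..}" "q y \<in> {0..}"
        using q xy by simp_all
      ultimately show "(u * x) / b * \<psi> (q x) + (v * y) / b * \<psi> (q y) \<le> \<psi> w"
        using \<psi>(1) unfolding concave_on_iff w_def real_scaleR_def by blast
    qed (use b in simp)
    also have "\<dots> \<le> b * \<psi> (q b)"
    proof (intro mult_left_mono mono_onD[OF \<psi>(2)])
      \<comment> \<open>Clearing the denominator turns \<open>w \<le> q b\<close> into the concavity
        of \<open>b * q b\<close>.\<close>
      have "b * w = u * (x * q x) + v * (y * q y)"
        using b by (simp add: w_def field_simps)
      also have "\<dots> \<le> b * q b"
        using z xy uv by (simp add: concave_on_iff b_def)
      finally show "w \<le> q b"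
        using b by simp
    qed (use b w q in auto)
    finally show ?thesis .
  qed
  then show "u * (x * \<psi> (q x)) + v * (y * \<psi> (q y)) \<le> (u *\<^sub>R x + v *\<^sub>R y) * \<psi> (q (u *\<^sub>R x + v *\<^sub>R y))"
    by (simp add: b_def)
qed simp

lemma concave_on_power_ratio:
  assumes "0 < P" "0 < c"
  shows "concave_on {0..} (\<lambda>b. b * (c * power_ratio \<gamma> P b))"
proof -
  \<comment> \<open>The factor \<open>b\<close> cancels the division; at \<open>b = 0\<close> both
    sides vanish because \<open>0 < P\<close>.\<close>
  have eq: "b * (c * power_ratio \<gamma> P b) = c * min (\<gamma> * b) P" for b
    using assms by (simp add: power_ratio_def)
  have "u * (c * min (\<gamma> * x) P) + v * (c * min (\<gamma> * y) P) \<le> c * min (\<gamma> * (u * x + v * y)) P"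
    if uv: "0 \<le> u" "0 \<le> v" "u + v = 1" for u v x y :: real
  proof -
    have "u * min (\<gamma> * x) P + v * min (\<gamma> * y) P \<le> u * (\<gamma> * x) + v * (\<gamma> * y)"
      and "u * min (\<gamma> * x) P + v * min (\<gamma> * y) P \<le> u * P + v * P"
      using uv by (intro add_mono mult_left_mono; simp)+
    moreover have "u * P + v * P = P"
      using uv by (simp flip: distrib_right)
    ultimately have "u * min (\<gamma> * x) P + v * min (\<gamma> * y) P \<le> min (\<gamma> * (u * x + v * y)) P"
      by (simp add: algebra_simps)
    then have "c * (u * min (\<gamma> * x) P + v * min (\<gamma> * y) P) \<le> c * min (\<gamma> * (u * x + v * y)) P"
      using assms by (intro mult_left_mono) auto
    then show ?thesis
      by (simp add: algebra_simps)
  qed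
  then show ?thesis
    by (simp add: eq concave_on_iff)
qed

section \<open>Summation over the coordinates\<close>

theorem lemmaV1:
  fixes P I :: real
    and G \<gamma> :: "'n::finite \<Rightarrow> real"
    and \<psi> :: "real \<Rightarrow> real"
    and f :: "'n \<Rightarrow> real \<Rightarrow> real"
  assumes "P > 0" and "I > 0"
    and "\<And>i. G i > 0" and "\<And>i. \<gamma> i > 0"
    and "\<And>t. t \<ge> 0 \<Longrightarrow> \<psi> t \<ge> 0"
    and "mono_on {0..} \<psi>" and "concave_on {0..} \<psi>" and "\<psi> differentiable_on {0..}"
    and "\<And>i. best_effort_reward (f i) \<or> delay_qos_reward (f i)"
  shows "concave_on {b :: real ^ 'n. \<forall>i. b $ i \<ge> 0}
    (\<lambda>b. \<Sum>i\<in>UNIV. f i (b $ i * \<psi> (G i / I * power_ratio (\<gamma> i) P (b $ i))))"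
proof -
  define h where "h i b = f i (b * \<psi> (G i / I * power_ratio (\<gamma> i) P b))" for i b
  have f: "concave_on {0..} (f i)" "mono_on {0..} (f i)" for i
    using assms(9)[of i] best_effort_reward_concave_mono[of "f i"]
      delay_qos_reward_concave_mono[of "f i"] by auto
  have q: "0 \<le> G i / I * power_ratio (\<gamma> i) P b" if "0 \<le> b" for i b
  proof -
    have "0 \<le> power_ratio (\<gamma> i) P b"
      using assms(1) assms(4)[of i] that by (simp add: power_ratio_def)
    then show ?thesis
      using assms(2) assms(3)[of i] by simp
  qed
  have "concave_on {0..} (\<lambda>b. b * \<psi> (G i / I * power_ratio (\<gamma> i) P b))" for i
    by (rule concave_on_perspective[OF assms(7,6) q concave_on_power_ratio])
      (simp_all add: assms(1-3))
  then have h: "concave_on {0..} (h i)" for i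
    unfolding h_def by (rule concave_on_mono_compose[OF f]) (use assms(5) q in fastforce)
  \<comment> \<open>Each summand depends on one coordinate, and coordinates of a convex combination
    are convex combinations, so the scalar inequalities add up.\<close>
  have "concave_on {b :: real ^ 'n. \<forall>i. b $ i \<ge> 0} (\<lambda>b. \<Sum>i\<in>UNIV. h i (b $ i))"
    unfolding concave_on_iff
  proof (intro conjI ballI allI impI)
    show "convex {b :: real ^ 'n. \<forall>i. b $ i \<ge> 0}"
      by (auto simp: convex_def)
    fix x y :: "real ^ 'n" and u v :: real
    assume xy: "x \<in> {b. \<forall>i. b $ i \<ge> 0}" "y \<in> {b. \<forall>i. b $ i \<ge> 0}"
      and uv: "0 \<le> u" "0 \<le> v" "u + v = 1"
    have "u * h i (x $ i) + v * h i (y $ i) \<le> h i ((u *\<^sub>R x + v *\<^sub>R y) $ i)" for i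
      using h[of i] xy uv by (simp add: concave_on_iff)
    then show "u * (\<Sum>i\<in>UNIV. h i (x $ i)) + v * (\<Sum>i\<in>UNIV. h i (y $ i))
        \<le> (\<Sum>i\<in>UNIV. h i ((u *\<^sub>R x + v *\<^sub>R y) $ i))"
      by (simp add: sum_distrib_left sum_mono flip: sum.distrib)
  qed
  then show ?thesis
    by (simp add: h_def)
qed

end
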